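(* For a Tychonoff space $X$, the following assertions are equivalent: (i) $X$ is closely embedded into $\prod_{\alpha\in\mathcal{A}}C_p(K_\alpha)$ for some family $\{K_\alpha\}_{\alpha\in\mathcal{A}}$ of compact spaces; (ii) $X$ is closely embedded into $C_p(Y)$, where $Y$ is the topological sum of a family of compact spaces; (iii) $X$ is closely embedded into $C_p(Y)$ for some locally compact paracompact space $Y$; (iv) $X$ is closely embedded into $C_p(Y)$ for some locally compact space $Y$; (v) $X$ is closely embedded into $C_p(Y)$ for some $k$-space $Y$; (vi) $X$ is closely embedded into $C_p(Y)$ for some $k_{\mathbb{R}}$-space $Y$; (vii) the diagonal mapping $$\psi: X\to\prod_{K\in\mathcal{K}(C_p(X))}C_p(K),\qquad \psi(x):=\big(\phi_K(x)\big)_{K\in\mathcal{K}(C_p(X))},$$ is an embedding with closed image, where $\phi_K:X\to C_p(K)$ is defined by $\phi_K(x)(s):=s(x)$ for $s\in K$.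
   Context: All spaces (including compact, locally compact, $k$- and $k_{\mathbb{R}}$-spaces) are Tychonoff. $C_p(Y)$ is the set $C(Y)$ of all continuous real-valued functions on $Y$ with the topology of pointwise convergence. $\mathcal{K}(Z)$ denotes the family of all compact subsets of a space $Z$. A space $X$ is closely embedded into a space $Y$ if there is a (topological) embedding $f:X\to Y$ whose image $f(X)$ is closed in $Y$. A Tychonoff space $Y$ is a $k$-space if for each non-closed subset $A\subseteq Y$ there is a compact $K\subseteq Y$ such that $A\cap K$ is not closed in $K$; it is a $k_{\mathbb{R}}$-space if every function $f:Y\to\mathbb{R}$ whose restriction to each compact subset of $Y$ is continuous is itself continuous. *)

theory Defs
  imports "HOL-Analysis.Analysis"
begin

definition Tychonoff_space :: "'a topology \<Rightarrow> bool" where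
  "Tychonoff_space X \<longleftrightarrow> t1_space X \<and> completely_regular_space X"

text \<open>
  Points of \<open>Cp Y\<close> are functions that are extensional outside \<open>topspace Y\<close> (this is
  forced by \<^const>\<open>product_topology\<close>), so each continuous function on \<open>Y\<close> is represented
  exactly once.
\<close>

definition Cp :: "'a topology \<Rightarrow> ('a \<Rightarrow> real) topology" where
  "Cp Y = subtopology (product_topology (\<lambda>_. euclideanreal) (topspace Y))
            {f. continuous_map Y euclideanreal f}"

definition closed_embedding_map :: "'a topology \<Rightarrow> 'b topology \<Rightarrow> ('a \<Rightarrow> 'b) \<Rightarrow> bool" where
  "closed_embedding_map X Y f \<longleftrightarrow> embedding_map X Y f \<and> closedin Y (f ` topspace X)"

definition closely_embedded :: "'a topology \<Rightarrow> 'b topology \<Rightarrow> bool" where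
  "closely_embedded X Y \<longleftrightarrow> (\<exists>f. closed_embedding_map X Y f)"

definition paracompact_space :: "'a topology \<Rightarrow> bool" where
  "paracompact_space X \<longleftrightarrow>
     (\<forall>\<U>. (\<forall>U\<in>\<U>. openin X U) \<and> \<Union>\<U> = topspace X \<longrightarrow>
        (\<exists>\<V>. (\<forall>V\<in>\<V>. openin X V \<and> (\<exists>U\<in>\<U>. V \<subseteq> U)) \<and> \<Union>\<V> = topspace X \<and>
             locally_finite_in X \<V>))"

definition kR_space :: "'a topology \<Rightarrow> bool" where
  "kR_space X \<longleftrightarrow>
     (\<forall>f. (\<forall>K. compactin X K \<longrightarrow> continuous_map (subtopology X K) euclideanreal f) \<longrightarrow>
          continuous_map X euclideanreal f)"

text \<open>
  A formula of HOL cannot quantify over spaces on all types at once.  Each of the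
  following existential assertions therefore takes type arguments saying on which types the
  auxiliary spaces (and the index set) live.
\<close>

definition embeds_Cp_product :: "'i itself \<Rightarrow> 'k itself \<Rightarrow> 'a topology \<Rightarrow> bool" where
  "embeds_Cp_product I T X \<longleftrightarrow>
     (\<exists>(A :: 'i set) (K :: 'i \<Rightarrow> 'k topology).
        (\<forall>\<alpha>\<in>A. Tychonoff_space (K \<alpha>) \<and> compact_space (K \<alpha>)) \<and>
        closely_embedded X (product_topology (\<lambda>\<alpha>. Cp (K \<alpha>)) A))"

definition embeds_Cp_compact_sum :: "'i itself \<Rightarrow> 'k itself \<Rightarrow> 'a topology \<Rightarrow> bool" where
  "embeds_Cp_compact_sum I T X \<longleftrightarrow>
     (\<exists>(A :: 'i set) (K :: 'i \<Rightarrow> 'k topology).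
        (\<forall>\<alpha>\<in>A. Tychonoff_space (K \<alpha>) \<and> compact_space (K \<alpha>)) \<and>
        closely_embedded X (Cp (sum_topology K A)))"

definition embeds_Cp_locally_compact_paracompact :: "'y itself \<Rightarrow> 'a topology \<Rightarrow> bool" where
  "embeds_Cp_locally_compact_paracompact T X \<longleftrightarrow>
     (\<exists>Y :: 'y topology. Tychonoff_space Y \<and> locally_compact_space Y \<and> paracompact_space Y \<and>
        closely_embedded X (Cp Y))"

definition embeds_Cp_locally_compact :: "'y itself \<Rightarrow> 'a topology \<Rightarrow> bool" where
  "embeds_Cp_locally_compact T X \<longleftrightarrow>
     (\<exists>Y :: 'y topology. Tychonoff_space Y \<and> locally_compact_space Y \<and> closely_embedded X (Cp Y))"

definition embeds_Cp_k_space :: "'y itself \<Rightarrow> 'a topology \<Rightarrow> bool" where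
  "embeds_Cp_k_space T X \<longleftrightarrow>
     (\<exists>Y :: 'y topology. Tychonoff_space Y \<and> k_space Y \<and> closely_embedded X (Cp Y))"

definition embeds_Cp_kR_space :: "'y itself \<Rightarrow> 'a topology \<Rightarrow> bool" where
  "embeds_Cp_kR_space T X \<longleftrightarrow>
     (\<exists>Y :: 'y topology. Tychonoff_space Y \<and> kR_space Y \<and> closely_embedded X (Cp Y))"

definition eval_on :: "('a \<Rightarrow> real) set \<Rightarrow> 'a \<Rightarrow> ('a \<Rightarrow> real) \<Rightarrow> real" where
  "eval_on K x = (\<lambda>s\<in>K. s x)"

definition diagonal_map :: "'a topology \<Rightarrow> 'a \<Rightarrow> ('a \<Rightarrow> real) set \<Rightarrow> ('a \<Rightarrow> real) \<Rightarrow> real" where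
  "diagonal_map X x = (\<lambda>K\<in>{K. compactin (Cp X) K}. eval_on K x)"

definition diagonal_closed_embedding :: "'a topology \<Rightarrow> bool" where
  "diagonal_closed_embedding X \<longleftrightarrow>
     closed_embedding_map X
       (product_topology (\<lambda>K. Cp (subtopology (Cp X) K)) {K. compactin (Cp X) K})
       (diagonal_map X)"

end

theory Submission
  imports Defs
begin

text \<open>
  The only substantial implication leads from a closed embedding \<open>h : X \<rightarrow> Cp Y\<close>, with \<open>Y\<close> a
  \<open>k\<^sub>R\<close>-space, to the closed embedding \<open>\<psi>\<close> into \<open>Z = \<Prod>\<^sub>K Cp K\<close> (lemma
  \<open>kR_closely_embedded_imp_diagonal\<close>).  The adjoint \<open>\<Phi> : Y \<rightarrow> Cp X\<close>, \<open>\<Phi> y x = h x y\<close>, is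
  continuous, so it maps compact sets \<open>L\<close> to compact sets \<open>\<Phi> L\<close>.  From a point \<open>z\<close> of \<open>Z\<close> one
  reads off a function \<open>P z\<close> on \<open>Y\<close> by \<open>P z y = z {\<Phi> y} (\<Phi> y)\<close>, so that \<open>P (\<psi> x) = h x\<close>.  The
  coherence relations \<open>z {s} s = z K s\<close> for \<open>s \<in> K\<close> hold on the image of \<open>\<psi>\<close>, hence on its
  closure \<open>A\<close>; for \<open>z \<in> A\<close> they give \<open>P z = z (\<Phi> L) \<circ> \<Phi>\<close> on each compact \<open>L\<close>, so \<open>P z\<close> is
  continuous on \<open>Y\<close> by the \<open>k\<^sub>R\<close>-property.  Thus \<open>P\<close> maps \<open>A\<close> continuously to \<open>Cp Y\<close>, and the
  preimage \<open>W\<close> of the closed set \<open>h X\<close> is closed in \<open>Z\<close>.  On \<open>W\<close> the map \<open>h\<^sup>-\<^sup>1 \<circ> P\<close> is a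
  continuous left inverse of \<open>\<psi>\<close>, and a map with a continuous left inverse on a closed subset of a
  Hausdorff space is a closed embedding.

  The remaining implications form a chain: \<open>\<psi>\<close> itself witnesses an embedding into a product,
  \<open>\<Prod>\<^sub>\<alpha> Cp (K \<alpha>)\<close> is homeomorphic to \<open>Cp\<close> of the topological sum of the \<open>K \<alpha>\<close>, such a sum is
  locally compact and paracompact, locally compact spaces are \<open>k\<close>-spaces, and \<open>k\<close>-spaces are
  \<open>k\<^sub>R\<close>-spaces.  The index set and the spaces \<open>K \<alpha>\<close> are kept when passing from products to sums,
  and the sum lives on the product of the two types.  Hence every type used in the chain, when it
  starts from \<open>\<psi>\<close>, is determined by the type of \<open>X\<close>, whereas the way back to \<open>\<psi>\<close> works for
  arbitrary types.
\<close>

section \<open>The topology of pointwise convergence\<close>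

lemma topspace_Cp:
  "topspace (Cp Y) = {f. f \<in> extensional (topspace Y) \<and> continuous_map Y euclideanreal f}"
  by (auto simp: Cp_def PiE_def)

lemma continuous_map_Cp_eval:
  assumes "y \<in> topspace Y"
  shows "continuous_map (Cp Y) euclideanreal (\<lambda>f. f y)"
  unfolding Cp_def
  using assms by (intro continuous_map_from_subtopology continuous_map_product_projection)

lemma continuous_map_into_Cp:
  "continuous_map X (Cp Y) F \<longleftrightarrow>
     F \<in> topspace X \<rightarrow> topspace (Cp Y) \<and>
     (\<forall>y\<in>topspace Y. continuous_map X euclideanreal (\<lambda>x. F x y))"
  unfolding topspace_Cp unfolding Cp_def
  by (auto simp: continuous_map_in_subtopology continuous_map_componentwise)

lemma restrict_in_topspace_Cp:
  assumes "continuous_map Y euclideanreal f"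
  shows "restrict f (topspace Y) \<in> topspace (Cp Y)"
  using continuous_map_eq[OF assms, of "restrict f (topspace Y)"] by (simp add: topspace_Cp)

lemma Hausdorff_space_Cp: "Hausdorff_space (Cp Y)"
  unfolding Cp_def
  by (intro Hausdorff_space_subtopology) (simp add: Hausdorff_space_product_topology)

lemma completely_regular_euclideanreal: "completely_regular_space euclideanreal"
  using metrizable_imp_completely_regular_space metrizable_space_euclidean by blast

lemma Tychonoff_space_Cp: "Tychonoff_space (Cp Y)"
proof -
  have "completely_regular_space (Cp Y)"
    unfolding Cp_def
    by (intro completely_regular_space_subtopology)
      (simp add: completely_regular_space_product_topology completely_regular_euclideanreal)
  then show ?thesis
    by (simp add: Tychonoff_space_def Hausdorff_imp_t1_space Hausdorff_space_Cp)
qed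

lemma Tychonoff_space_subtopology:
  "Tychonoff_space X \<Longrightarrow> Tychonoff_space (subtopology X S)"
  by (simp add: Tychonoff_space_def t1_space_subtopology completely_regular_space_subtopology)

lemma Tychonoff_imp_Hausdorff_space: "Tychonoff_space X \<Longrightarrow> Hausdorff_space X"
  by (simp add: Tychonoff_space_def completely_regular_imp_regular_space
      regular_t1_imp_Hausdorff_space)


section \<open>Closed embeddings\<close>

text \<open>
  The image is a retract of the Hausdorff space \<open>W\<close>, hence closed in \<open>W\<close> and so in \<open>Z\<close>.
\<close>
lemma closed_embedding_map_of_retraction:
  assumes "Hausdorff_space Z" "closedin Z W" "retraction_maps (subtopology Z W) X g f"
  shows "closed_embedding_map X Z f"
proof -
  have "embedding_map X (subtopology Z W) f"
    using assms(3) section_imp_embedding_map section_map_def by blast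
  then have "embedding_map X Z f"
    by (simp add: embedding_map_in_subtopology)
  moreover have "closedin (subtopology Z W) (f ` topspace X)"
    using retraction_maps_section_image1[OF assms(3)]
    by (intro retract_of_space_imp_closedin Hausdorff_space_subtopology assms(1))
  then have "closedin Z (f ` topspace X)"
    using assms(2) closedin_trans_full by blast
  ultimately show ?thesis
    by (simp add: closed_embedding_map_def)
qed

lemma closely_embedded_homeomorphic_space:
  assumes "closely_embedded X Y" "Y homeomorphic_space Z"
  shows "closely_embedded X Z"
proof -
  obtain f where f: "embedding_map X Y f" "closedin Y (f ` topspace X)"
    using assms(1) by (auto simp: closely_embedded_def closed_embedding_map_def)
  obtain g where g: "homeomorphic_map Y Z g"
    using assms(2) homeomorphic_space by blast
  have "embedding_map X Z (g \<circ> f)"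
    using f(1) g embedding_map_compose surjective_embedding_map by blast
  moreover have "closedin Z ((g \<circ> f) ` topspace X)"
    using f(2) homeomorphic_imp_closed_map[OF g]
    unfolding closed_map_def image_comp[symmetric] by blast
  ultimately show ?thesis
    by (auto simp: closely_embedded_def closed_embedding_map_def)
qed


section \<open>Topological sums of compact spaces\<close>

lemma continuous_map_from_sum_topology:
  "continuous_map (sum_topology K A) Y f \<longleftrightarrow>
     (\<forall>\<alpha>\<in>A. continuous_map (K \<alpha>) Y (\<lambda>x. f (\<alpha>, x)))"
proof
  assume "continuous_map (sum_topology K A) Y f"
  then show "\<forall>\<alpha>\<in>A. continuous_map (K \<alpha>) Y (\<lambda>x. f (\<alpha>, x))"
    using continuous_map_compose[OF continuous_map_component_injection] by (fastforce simp: o_def)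
next
  assume R: "\<forall>\<alpha>\<in>A. continuous_map (K \<alpha>) Y (\<lambda>x. f (\<alpha>, x))"
  show "continuous_map (sum_topology K A) Y f"
    unfolding continuous_map_def
  proof (intro conjI allI impI)
    show "f \<in> topspace (sum_topology K A) \<rightarrow> topspace Y"
      using R by (auto simp: continuous_map_def Pi_iff)
    fix U assume "openin Y U"
    with R show "openin (sum_topology K A) {x \<in> topspace (sum_topology K A). f x \<in> U}"
      by (auto simp: openin_sum_topology continuous_map_def)
  qed
qed

text \<open>
  The homeomorphism is currying; the restrictions in both directions produce the values outside the
  domains that points of \<^const>\<open>Cp\<close> and of product spaces must have.
\<close>
lemma product_Cp_homeomorphic_Cp_sum:
  "product_topology (\<lambda>\<alpha>. Cp (K \<alpha>)) A homeomorphic_space Cp (sum_topology K A)"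
proof -
  let ?P = "product_topology (\<lambda>\<alpha>. Cp (K \<alpha>)) A" and ?S = "sum_topology K A"
  define F where "F = (\<lambda>z. \<lambda>p\<in>topspace ?S. z (fst p) (snd p) :: real)"
  define G where "G = (\<lambda>f. \<lambda>\<alpha>\<in>A. \<lambda>k\<in>topspace (K \<alpha>). f (\<alpha>, k) :: real)"
  have comp: "z \<alpha> \<in> extensional (topspace (K \<alpha>))" "continuous_map (K \<alpha>) euclideanreal (z \<alpha>)"
    if "z \<in> topspace ?P" "\<alpha> \<in> A" for z \<alpha>
    using that by (auto simp: PiE_iff topspace_Cp)
  have "continuous_map ?P (Cp ?S) F"
    unfolding continuous_map_into_Cp
  proof (intro conjI ballI)
    show "F \<in> topspace ?P \<rightarrow> topspace (Cp ?S)"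
    proof
      fix z assume "z \<in> topspace ?P"
      then have "continuous_map ?S euclideanreal (\<lambda>p. z (fst p) (snd p))"
        using comp(2) by (simp add: continuous_map_from_sum_topology eta_contract_eq)
      then show "F z \<in> topspace (Cp ?S)"
        unfolding F_def by (rule restrict_in_topspace_Cp)
    qed
    fix p assume p: "p \<in> topspace ?S"
    then obtain \<alpha> k where \<alpha>: "p = (\<alpha>, k)" "\<alpha> \<in> A" "k \<in> topspace (K \<alpha>)"
      by auto
    have "continuous_map ?P (Cp (K \<alpha>)) (\<lambda>z. z \<alpha>)"
      using \<alpha>(2) by (rule continuous_map_product_projection)
    from continuous_map_compose[OF this continuous_map_Cp_eval[OF \<alpha>(3)]]
    have "continuous_map ?P euclideanreal (\<lambda>z. z \<alpha> k)"
      by (simp add: o_def)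
    then show "continuous_map ?P euclideanreal (\<lambda>z. F z p)"
      using p \<alpha>(1) by (simp add: F_def)
  qed
  moreover have "continuous_map (Cp ?S) ?P G"
    unfolding continuous_map_componentwise continuous_map_into_Cp
  proof (intro conjI ballI)
    show "G ` topspace (Cp ?S) \<subseteq> extensional A"
      by (auto simp: G_def)
    fix \<alpha> assume \<alpha>: "\<alpha> \<in> A"
    show "(\<lambda>f. G f \<alpha>) \<in> topspace (Cp ?S) \<rightarrow> topspace (Cp (K \<alpha>))"
    proof
      fix f assume "f \<in> topspace (Cp ?S)"
      then have "continuous_map (K \<alpha>) euclideanreal (\<lambda>k. f (\<alpha>, k))"
        using \<alpha> by (simp add: topspace_Cp continuous_map_from_sum_topology)
      then show "G f \<alpha> \<in> topspace (Cp (K \<alpha>))"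
        using \<alpha> restrict_in_topspace_Cp by (simp add: G_def)
    qed
    fix k assume "k \<in> topspace (K \<alpha>)"
    with \<alpha> show "continuous_map (Cp ?S) euclideanreal (\<lambda>f. G f \<alpha> k)"
      using continuous_map_Cp_eval[of "(\<alpha>, k)" ?S] by (simp add: G_def)
  qed
  moreover have "G (F z) = z" if z: "z \<in> topspace ?P" for z
  proof (rule extensionalityI[of _ A])
    show "z \<in> extensional A"
      using z by (simp add: PiE_iff)
    fix \<alpha> assume \<alpha>: "\<alpha> \<in> A"
    show "G (F z) \<alpha> = z \<alpha>"
      using \<alpha> comp(1)[OF z \<alpha>]
      by (intro extensionalityI[of _ "topspace (K \<alpha>)"]) (auto simp: F_def G_def)
  qed (simp add: G_def)
  moreover have "F (G f) = f" if "f \<in> topspace (Cp ?S)" for f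
    using that
    by (intro extensionalityI[of _ "topspace ?S"]) (auto simp: F_def G_def topspace_Cp)
  ultimately show ?thesis
    unfolding homeomorphic_space_def homeomorphic_maps_def by blast
qed

lemma Hausdorff_space_sum_topology:
  assumes "\<And>\<alpha>. \<alpha> \<in> A \<Longrightarrow> Hausdorff_space (K \<alpha>)"
  shows "Hausdorff_space (sum_topology K A)"
  unfolding Hausdorff_space_def
proof (intro allI impI, elim conjE)
  fix p q
  assume p: "p \<in> topspace (sum_topology K A)" and q: "q \<in> topspace (sum_topology K A)"
    and "p \<noteq> q"
  obtain \<alpha> x where px: "p = (\<alpha>, x)" "\<alpha> \<in> A" "x \<in> topspace (K \<alpha>)"
    using p by auto
  obtain \<beta> y where qy: "q = (\<beta>, y)" "\<beta> \<in> A" "y \<in> topspace (K \<beta>)"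
    using q by auto
  have op: "openin (sum_topology K A) (Pair \<gamma> ` U)" if "\<gamma> \<in> A" "openin (K \<gamma>) U" for \<gamma> U
    using open_map_component_injection[OF that(1), of K] that(2) by (simp add: open_map_def)
  show "\<exists>U V. openin (sum_topology K A) U \<and> openin (sum_topology K A) V \<and>
          p \<in> U \<and> q \<in> V \<and> disjnt U V"
  proof (cases "\<alpha> = \<beta>")
    case True
    then obtain U V where "openin (K \<alpha>) U" "openin (K \<alpha>) V" "x \<in> U" "y \<in> V" "disjnt U V"
      using assms[OF px(2)] px qy \<open>p \<noteq> q\<close> unfolding Hausdorff_space_def by blast
    with True px qy show ?thesis
      by (intro exI[of _ "Pair \<alpha> ` U"] exI[of _ "Pair \<alpha> ` V"]) (auto simp: op disjnt_def)
  next
    case False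
    with px qy show ?thesis
      by (intro exI[of _ "Pair \<alpha> ` topspace (K \<alpha>)"] exI[of _ "Pair \<beta> ` topspace (K \<beta>)"])
        (auto simp: op disjnt_def)
  qed
qed

text \<open>
  Each summand \<open>B \<alpha>\<close> is covered by finitely many members of the given cover.  Cutting these down to
  \<open>B \<alpha>\<close> gives the refinement, which is locally finite because the \<open>B \<alpha>\<close> are open and disjoint.
\<close>
lemma paracompact_space_sum_topology_compact:
  assumes "\<And>\<alpha>. \<alpha> \<in> A \<Longrightarrow> compact_space (K \<alpha>)"
  shows "paracompact_space (sum_topology K A)"
  unfolding paracompact_space_def
proof (intro allI impI, elim conjE)
  let ?S = "sum_topology K A"
  fix \<U>
  assume opU: "\<forall>U\<in>\<U>. openin ?S U" and covU: "\<Union>\<U> = topspace ?S"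
  define B where "B = (\<lambda>\<alpha>. Pair \<alpha> ` topspace (K \<alpha>))"
  have opB: "openin ?S (B \<alpha>)" if "\<alpha> \<in> A" for \<alpha>
    using open_map_component_injection[OF that, of K] by (simp add: open_map_def B_def)
  have "\<exists>\<F>. finite \<F> \<and> \<F> \<subseteq> \<U> \<and> B \<alpha> \<subseteq> \<Union>\<F>" if "\<alpha> \<in> A" for \<alpha>
  proof (rule compactinD)
    show "compactin ?S (B \<alpha>)"
      using assms[OF that] continuous_map_component_injection[OF that]
      unfolding B_def compact_space_def by (rule image_compactin)
    show "B \<alpha> \<subseteq> \<Union>\<U>"
      using that by (auto simp: covU B_def)
  qed (use opU in auto)
  then obtain F where F: "\<And>\<alpha>. \<alpha> \<in> A \<Longrightarrow> finite (F \<alpha>) \<and> F \<alpha> \<subseteq> \<U> \<and> B \<alpha> \<subseteq> \<Union>(F \<alpha>)"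
    by metis
  define \<V> where "\<V> = (\<Union>\<alpha>\<in>A. (\<lambda>U. B \<alpha> \<inter> U) ` F \<alpha>)"
  have ref: "openin ?S V \<and> (\<exists>U\<in>\<U>. V \<subseteq> U)" if "V \<in> \<V>" for V
    using that F opB opU unfolding \<V>_def by blast
  have sub: "\<Union>\<V> \<subseteq> topspace ?S"
    using ref openin_subset by blast
  have "topspace ?S \<subseteq> \<Union>\<V>"
  proof
    fix p assume "p \<in> topspace ?S"
    then obtain \<alpha> where "\<alpha> \<in> A" "p \<in> B \<alpha>"
      by (auto simp: B_def)
    with F[of \<alpha>] show "p \<in> \<Union>\<V>"
      unfolding \<V>_def by blast
  qed
  moreover have "locally_finite_in ?S \<V>"
    unfolding locally_finite_in_def
  proof (intro conjI ballI sub)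
    fix p assume "p \<in> topspace ?S"
    then obtain \<alpha> where \<alpha>: "\<alpha> \<in> A" "p \<in> B \<alpha>"
      by (auto simp: B_def)
    have "V \<in> (\<lambda>U. B \<alpha> \<inter> U) ` F \<alpha>" if V: "V \<in> \<V>" "V \<inter> B \<alpha> \<noteq> {}" for V
    proof -
      obtain \<beta> U where \<beta>: "U \<in> F \<beta>" "V = B \<beta> \<inter> U"
        using V(1) unfolding \<V>_def by blast
      have "\<beta> = \<alpha>"
        using V(2) \<beta>(2) by (auto simp: B_def)
      with \<beta> show ?thesis by blast
    qed
    then have "{V \<in> \<V>. V \<inter> B \<alpha> \<noteq> {}} \<subseteq> (\<lambda>U. B \<alpha> \<inter> U) ` F \<alpha>"
      by auto
    then have "finite {V \<in> \<V>. V \<inter> B \<alpha> \<noteq> {}}"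
      using F[OF \<alpha>(1)] by (auto intro: finite_surj)
    with \<alpha> opB[OF \<alpha>(1)] show "\<exists>V. openin ?S V \<and> p \<in> V \<and> finite {U \<in> \<V>. U \<inter> V \<noteq> {}}"
      by (intro exI[of _ "B \<alpha>"]) simp
  qed
  ultimately show "\<exists>\<V>. (\<forall>V\<in>\<V>. openin ?S V \<and> (\<exists>U\<in>\<U>. V \<subseteq> U)) \<and> \<Union>\<V> = topspace ?S \<and>
      locally_finite_in ?S \<V>"
    using ref sub by (intro exI[of _ \<V>] conjI ballI equalityI) auto
qed


section \<open>The diagonal map\<close>

lemma kR_closely_embedded_imp_diagonal:
  fixes X :: "'a topology" and Y :: "'b topology"
  assumes kR: "kR_space Y" and emb: "closely_embedded X (Cp Y)"
  shows "diagonal_closed_embedding X"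
proof -
  define \<K> where "\<K> = {K. compactin (Cp X) K}"
  define Z where "Z = product_topology (\<lambda>K. Cp (subtopology (Cp X) K)) \<K>"
  define \<psi> where "\<psi> = diagonal_map X"
  obtain h where h: "embedding_map X (Cp Y) h" "closedin (Cp Y) (h ` topspace X)"
    using emb by (auto simp: closely_embedded_def closed_embedding_map_def)
  obtain h' where h': "homeomorphic_maps X (subtopology (Cp Y) (h ` topspace X)) h h'"
    using h(1) by (auto simp: embedding_map_def homeomorphic_map_maps)
  have conth: "continuous_map X (Cp Y) h"
    using h' continuous_map_in_subtopology by (auto simp: homeomorphic_maps_def)
  have h'h: "h' (h x) = x" if "x \<in> topspace X" for x
    using h' that by (simp add: homeomorphic_maps_def)
  have hx: "h x \<in> extensional (topspace Y)" "continuous_map Y euclideanreal (h x)"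
    if "x \<in> topspace X" for x
    using conth that by (auto simp: continuous_map_into_Cp topspace_Cp Pi_iff)
  have top: "topspace (subtopology (Cp X) K) = K" if "K \<in> \<K>" for K
    using that compactin_subset_topspace by (fastforce simp: \<K>_def)

  have evZ: "continuous_map Z euclideanreal (\<lambda>z. z K s)" if "K \<in> \<K>" "s \<in> K" for K s
  proof -
    have "s \<in> topspace (subtopology (Cp X) K)"
      using that top by simp
    then have "continuous_map (Cp (subtopology (Cp X) K)) euclideanreal (\<lambda>f. f s)"
      by (rule continuous_map_Cp_eval)
    moreover have "continuous_map Z (Cp (subtopology (Cp X) K)) (\<lambda>z. z K)"
      unfolding Z_def using that(1) by (rule continuous_map_product_projection)
    ultimately have "continuous_map Z euclideanreal ((\<lambda>f. f s) \<circ> (\<lambda>z. z K))"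
      using continuous_map_compose by blast
    then show ?thesis
      by (simp add: o_def)
  qed
  have \<psi>_eval: "\<psi> x K s = s x" if "K \<in> \<K>" "s \<in> K" for x K s
    using that by (simp add: \<psi>_def diagonal_map_def eval_on_def \<K>_def)
  have cont\<psi>: "continuous_map X Z \<psi>"
    unfolding Z_def continuous_map_componentwise continuous_map_into_Cp
  proof (intro conjI ballI)
    show "\<psi> ` topspace X \<subseteq> extensional \<K>"
      by (auto simp: \<psi>_def diagonal_map_def \<K>_def)
    fix K assume K: "K \<in> \<K>"
    show "(\<lambda>x. \<psi> x K) \<in> topspace X \<rightarrow> topspace (Cp (subtopology (Cp X) K))"
    proof
      fix x assume "x \<in> topspace X"
      then have "continuous_map (subtopology (Cp X) K) euclideanreal (\<lambda>s. s x)"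
        by (intro continuous_map_from_subtopology continuous_map_Cp_eval)
      from restrict_in_topspace_Cp[OF this]
      show "\<psi> x K \<in> topspace (Cp (subtopology (Cp X) K))"
        using K unfolding top[OF K] by (simp add: \<psi>_def diagonal_map_def eval_on_def \<K>_def)
    qed
    fix s assume "s \<in> topspace (subtopology (Cp X) K)"
    then have "s \<in> K" "continuous_map X euclideanreal s"
      by (auto simp: topspace_Cp)
    then show "continuous_map X euclideanreal (\<lambda>x. \<psi> x K s)"
      using K by (simp add: \<psi>_eval eta_contract_eq)
  qed
  have HZ: "Hausdorff_space Z"
    unfolding Z_def by (simp add: Hausdorff_space_product_topology Hausdorff_space_Cp)

  \<comment> \<open>The adjoint of \<open>h\<close> is continuous because each \<open>h x\<close> is, and takes values in \<open>Cp X\<close> because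
    \<open>h\<close> is continuous.\<close>
  define \<Phi> where "\<Phi> = (\<lambda>y. \<lambda>x\<in>topspace X. h x y)"
  have cont\<Phi>: "continuous_map Y (Cp X) \<Phi>"
    unfolding continuous_map_into_Cp
  proof (intro conjI ballI)
    show "\<Phi> \<in> topspace Y \<rightarrow> topspace (Cp X)"
    proof
      fix y assume "y \<in> topspace Y"
      then have "continuous_map X euclideanreal (\<lambda>x. h x y)"
        using conth by (simp add: continuous_map_into_Cp)
      then show "\<Phi> y \<in> topspace (Cp X)"
        unfolding \<Phi>_def by (rule restrict_in_topspace_Cp)
    qed
    fix x assume "x \<in> topspace X"
    then show "continuous_map Y euclideanreal (\<lambda>y. \<Phi> y x)"
      using hx(2) by (simp add: \<Phi>_def eta_contract_eq)
  qed
  have sing: "{s} \<in> \<K>" if "s \<in> topspace (Cp X)" for s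
    using that by (simp add: \<K>_def)
  have \<Phi>top: "\<Phi> y \<in> topspace (Cp X)" if "y \<in> topspace Y" for y
    using cont\<Phi> that by (auto simp: continuous_map_def)

  \<comment> \<open>The singletons \<open>{\<Phi> y}\<close> make \<open>P\<close> defined and coordinatewise continuous on all of \<open>Z\<close>;
    the continuity of the function \<open>P z\<close> on \<open>Y\<close> needs coherence of \<open>z\<close>.\<close>
  define P where "P = (\<lambda>z :: ('a \<Rightarrow> real) set \<Rightarrow> ('a \<Rightarrow> real) \<Rightarrow> real.
                         \<lambda>y\<in>topspace Y. z {\<Phi> y} (\<Phi> y))"
  have P\<psi>: "P (\<psi> x) = h x" if x: "x \<in> topspace X" for x
  proof (rule extensionalityI[of _ "topspace Y"])
    fix y assume "y \<in> topspace Y"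
    with x show "P (\<psi> x) y = h x y"
      using \<psi>_eval[OF sing[OF \<Phi>top]] by (simp add: P_def \<Phi>_def)
  qed (use hx(1)[OF x] in \<open>auto simp: P_def\<close>)

  define A where "A = Z closure_of (\<psi> ` topspace X)"
  have A: "z \<in> topspace Z" if "z \<in> A" for z
    using that by (simp add: A_def in_closure_of)
  have \<psi>A: "\<psi> x \<in> A" if "x \<in> topspace X" for x
    using closure_of_subset[of "\<psi> ` topspace X" Z] continuous_map_image_subset_topspace[OF cont\<psi>]
      that by (auto simp: A_def)
  have coherent: "z {s} s = z K s" if "z \<in> A" "K \<in> \<K>" "s \<in> K" for z K s
  proof (rule forall_in_closure_of_eq[of z Z _ euclideanreal
        "\<lambda>z. z {s} s" "\<lambda>z. z K s"])
    have s: "{s} \<in> \<K>"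
      using that(2,3) compactin_subset_topspace by (intro sing) (auto simp: \<K>_def)
    show "z \<in> Z closure_of (\<psi> ` topspace X)"
      using that(1) by (simp add: A_def)
    show "continuous_map Z euclideanreal (\<lambda>z. z {s} s)" "continuous_map Z euclideanreal (\<lambda>z. z K s)"
      using evZ s that by auto
    show "w {s} s = w K s" if "w \<in> \<psi> ` topspace X" for w
      using that \<psi>_eval[OF s] \<psi>_eval[OF \<open>K \<in> \<K>\<close> \<open>s \<in> K\<close>] by auto
  qed simp
  have contP: "continuous_map (subtopology Z A) (Cp Y) P"
    unfolding continuous_map_into_Cp
  proof (intro conjI ballI)
    show "P \<in> topspace (subtopology Z A) \<rightarrow> topspace (Cp Y)"
    proof
      fix z assume "z \<in> topspace (subtopology Z A)"
      then have z: "z \<in> A" "z \<in> topspace Z"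
        by auto
      have "continuous_map (subtopology Y L) euclideanreal (\<lambda>y. z {\<Phi> y} (\<Phi> y))"
        if L: "compactin Y L" for L
      proof -
        have \<Phi>L: "\<Phi> ` L \<in> \<K>"
          using image_compactin[OF L cont\<Phi>] by (simp add: \<K>_def)
        \<comment> \<open>By coherence \<open>z {\<Phi> y} (\<Phi> y)\<close> is the value of the single continuous function
          \<open>z (\<Phi> ` L)\<close> at \<open>\<Phi> y\<close>.\<close>
        have "continuous_map (subtopology (Cp X) (\<Phi> ` L)) euclideanreal (z (\<Phi> ` L))"
          using z(2) \<Phi>L by (auto simp: Z_def topspace_Cp)
        moreover have "continuous_map (subtopology Y L) (subtopology (Cp X) (\<Phi> ` L)) \<Phi>"
          using cont\<Phi> by (auto simp: continuous_map_in_subtopology continuous_map_from_subtopology)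
        ultimately have "continuous_map (subtopology Y L) euclideanreal (z (\<Phi> ` L) \<circ> \<Phi>)"
          using continuous_map_compose by blast
        then show ?thesis
          by (rule continuous_map_eq) (simp add: coherent[OF z(1) \<Phi>L])
      qed
      then have "continuous_map Y euclideanreal (\<lambda>y. z {\<Phi> y} (\<Phi> y))"
        using kR unfolding kR_space_def by blast
      then show "P z \<in> topspace (Cp Y)"
        unfolding P_def by (rule restrict_in_topspace_Cp)
    qed
    fix y assume "y \<in> topspace Y"
    then show "continuous_map (subtopology Z A) euclideanreal (\<lambda>z. P z y)"
      using evZ[OF sing[OF \<Phi>top]] by (simp add: P_def continuous_map_from_subtopology)
  qed

  \<comment> \<open>\<open>P\<close> ignores the coordinates at functions outside \<open>\<Phi> Y\<close>, so \<open>P z = h x\<close> does not directly give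
    \<open>z = \<psi> x\<close>; the image of \<open>\<psi>\<close> is closed in \<open>W\<close> because it is a retract.\<close>
  define W where "W = {z \<in> topspace (subtopology Z A). P z \<in> h ` topspace X}"
  have "closedin (subtopology Z A) W"
    unfolding W_def by (rule closedin_continuous_map_preimage[OF contP h(2)])
  then have "closedin Z W"
    using closedin_trans_full[of Z A W] by (simp add: A_def)
  moreover have "retraction_maps (subtopology Z W) X (h' \<circ> P) \<psi>"
    unfolding retraction_maps_def
  proof (intro conjI ballI)
    have "W \<subseteq> A"
      by (auto simp: W_def)
    then have "continuous_map (subtopology Z W) (subtopology (Cp Y) (h ` topspace X)) P"
      using continuous_map_from_subtopology_mono[OF contP]
      by (auto simp: continuous_map_in_subtopology W_def)
    then show "continuous_map (subtopology Z W) X (h' \<circ> P)"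
      using h' continuous_map_compose by (auto simp: homeomorphic_maps_def)
    show "continuous_map X (subtopology Z W) \<psi>"
      using cont\<psi> \<psi>A A P\<psi> by (auto simp: continuous_map_in_subtopology W_def)
    show "(h' \<circ> P) (\<psi> x) = x" if "x \<in> topspace X" for x
      using that by (simp add: P\<psi> h'h)
  qed
  ultimately have "closed_embedding_map X Z \<psi>"
    using HZ closed_embedding_map_of_retraction by blast
  then show ?thesis
    by (simp add: diagonal_closed_embedding_def Z_def \<psi>_def \<K>_def)
qed


section \<open>The cycle of implications\<close>

lemma diagonal_imp_embeds_Cp_product:
  fixes X :: "'a topology"
  assumes "diagonal_closed_embedding X"
  shows "embeds_Cp_product TYPE(('a \<Rightarrow> real) set) TYPE('a \<Rightarrow> real) X"
  unfolding embeds_Cp_product_def closely_embedded_def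
proof (intro exI conjI ballI)
  show "closed_embedding_map X
      (product_topology (\<lambda>K. Cp (subtopology (Cp X) K)) {K. compactin (Cp X) K}) (diagonal_map X)"
    using assms by (simp add: diagonal_closed_embedding_def)
qed (auto simp: Tychonoff_space_subtopology Tychonoff_space_Cp compact_space_subtopology)

lemma embeds_Cp_product_imp_sum:
  assumes "embeds_Cp_product TYPE('i) TYPE('k) X"
  shows "embeds_Cp_compact_sum TYPE('i) TYPE('k) X"
  using assms closely_embedded_homeomorphic_space[OF _ product_Cp_homeomorphic_Cp_sum]
  unfolding embeds_Cp_product_def embeds_Cp_compact_sum_def by blast

lemma embeds_Cp_sum_imp_locally_compact_paracompact:
  assumes "embeds_Cp_compact_sum TYPE('i) TYPE('k) X"
  shows "embeds_Cp_locally_compact_paracompact TYPE('i \<times> 'k) X"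
proof -
  obtain A :: "'i set" and K :: "'i \<Rightarrow> 'k topology"
    where K: "\<And>\<alpha>. \<alpha> \<in> A \<Longrightarrow> Tychonoff_space (K \<alpha>)" "\<And>\<alpha>. \<alpha> \<in> A \<Longrightarrow> compact_space (K \<alpha>)"
      and emb: "closely_embedded X (Cp (sum_topology K A))"
    using assms unfolding embeds_Cp_compact_sum_def by blast
  have lc: "locally_compact_space (sum_topology K A)"
    using K(2) by (simp add: locally_compact_space_sum_topology compact_imp_locally_compact_space)
  have "Hausdorff_space (sum_topology K A)"
    using K(1) by (intro Hausdorff_space_sum_topology Tychonoff_imp_Hausdorff_space)
  with lc have "Tychonoff_space (sum_topology K A)"
    by (simp add: Tychonoff_space_def Hausdorff_imp_t1_space
        locally_compact_regular_imp_completely_regular_space)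
  moreover have "paracompact_space (sum_topology K A)"
    using K(2) by (rule paracompact_space_sum_topology_compact)
  ultimately show ?thesis
    using lc emb unfolding embeds_Cp_locally_compact_paracompact_def by metis
qed

lemma embeds_Cp_locally_compact_paracompact_imp_locally_compact:
  "embeds_Cp_locally_compact_paracompact TYPE('y) X \<Longrightarrow> embeds_Cp_locally_compact TYPE('y) X"
  unfolding embeds_Cp_locally_compact_paracompact_def embeds_Cp_locally_compact_def by blast

lemma embeds_Cp_locally_compact_imp_k_space:
  "embeds_Cp_locally_compact TYPE('y) X \<Longrightarrow> embeds_Cp_k_space TYPE('y) X"
  unfolding embeds_Cp_locally_compact_def embeds_Cp_k_space_def
  using locally_compact_imp_k_space by blast

lemma embeds_Cp_k_space_imp_kR_space:
  "embeds_Cp_k_space TYPE('y) X \<Longrightarrow> embeds_Cp_kR_space TYPE('y) X"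
  unfolding embeds_Cp_k_space_def embeds_Cp_kR_space_def kR_space_def
  using continuous_map_from_k_space by blast

lemma embeds_Cp_kR_space_imp_diagonal:
  "embeds_Cp_kR_space TYPE('y) X \<Longrightarrow> diagonal_closed_embedding X"
  unfolding embeds_Cp_kR_space_def using kR_closely_embedded_imp_diagonal by blast

lemma embeds_Cp_k_space_imp_diagonal:
  "embeds_Cp_k_space TYPE('y) X \<Longrightarrow> diagonal_closed_embedding X"
  by (intro embeds_Cp_kR_space_imp_diagonal embeds_Cp_k_space_imp_kR_space)

lemma embeds_Cp_locally_compact_imp_diagonal:
  "embeds_Cp_locally_compact TYPE('y) X \<Longrightarrow> diagonal_closed_embedding X"
  by (intro embeds_Cp_k_space_imp_diagonal embeds_Cp_locally_compact_imp_k_space)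

lemma embeds_Cp_locally_compact_paracompact_imp_diagonal:
  "embeds_Cp_locally_compact_paracompact TYPE('y) X \<Longrightarrow> diagonal_closed_embedding X"
  by (intro embeds_Cp_locally_compact_imp_diagonal
      embeds_Cp_locally_compact_paracompact_imp_locally_compact)

lemma embeds_Cp_compact_sum_imp_diagonal:
  "embeds_Cp_compact_sum TYPE('i) TYPE('k) X \<Longrightarrow> diagonal_closed_embedding X"
  by (rule embeds_Cp_locally_compact_paracompact_imp_diagonal[OF
        embeds_Cp_sum_imp_locally_compact_paracompact])

lemma embeds_Cp_product_imp_diagonal:
  "embeds_Cp_product TYPE('i) TYPE('k) X \<Longrightarrow> diagonal_closed_embedding X"
  by (intro embeds_Cp_compact_sum_imp_diagonal embeds_Cp_product_imp_sum)

theorem theorem3p1: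
  fixes X :: "'a topology"
  assumes "Tychonoff_space X"
  shows
    "((embeds_Cp_product TYPE(('a \<Rightarrow> real) set) TYPE('a \<Rightarrow> real) X
         \<longleftrightarrow> diagonal_closed_embedding X) \<and>
      (embeds_Cp_compact_sum TYPE(('a \<Rightarrow> real) set) TYPE('a \<Rightarrow> real) X
         \<longleftrightarrow> diagonal_closed_embedding X) \<and>
      (embeds_Cp_locally_compact_paracompact TYPE(('a \<Rightarrow> real) set \<times> ('a \<Rightarrow> real)) X
         \<longleftrightarrow> diagonal_closed_embedding X) \<and>
      (embeds_Cp_locally_compact TYPE(('a \<Rightarrow> real) set \<times> ('a \<Rightarrow> real)) X
         \<longleftrightarrow> diagonal_closed_embedding X) \<and>
      (embeds_Cp_k_space TYPE(('a \<Rightarrow> real) set \<times> ('a \<Rightarrow> real)) X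
         \<longleftrightarrow> diagonal_closed_embedding X) \<and>
      (embeds_Cp_kR_space TYPE(('a \<Rightarrow> real) set \<times> ('a \<Rightarrow> real)) X
         \<longleftrightarrow> diagonal_closed_embedding X)) \<and>
     ((embeds_Cp_product TYPE('i) TYPE('k) X \<longrightarrow> diagonal_closed_embedding X) \<and>
      (embeds_Cp_compact_sum TYPE('i) TYPE('k) X \<longrightarrow> diagonal_closed_embedding X) \<and>
      (embeds_Cp_locally_compact_paracompact TYPE('y) X \<longrightarrow> diagonal_closed_embedding X) \<and>
      (embeds_Cp_locally_compact TYPE('y) X \<longrightarrow> diagonal_closed_embedding X) \<and>
      (embeds_Cp_k_space TYPE('y) X \<longrightarrow> diagonal_closed_embedding X) \<and>
      (embeds_Cp_kR_space TYPE('y) X \<longrightarrow> diagonal_closed_embedding X))"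
proof -
  note to_diagonal = embeds_Cp_product_imp_diagonal embeds_Cp_compact_sum_imp_diagonal
    embeds_Cp_locally_compact_paracompact_imp_diagonal embeds_Cp_locally_compact_imp_diagonal
    embeds_Cp_k_space_imp_diagonal embeds_Cp_kR_space_imp_diagonal
  note from_product = diagonal_imp_embeds_Cp_product[of X]
  note from_sum = embeds_Cp_product_imp_sum[OF from_product]
  note from_paracompact = embeds_Cp_sum_imp_locally_compact_paracompact[OF from_sum]
  note from_locally_compact =
    embeds_Cp_locally_compact_paracompact_imp_locally_compact[OF from_paracompact]
  note from_k = embeds_Cp_locally_compact_imp_k_space[OF from_locally_compact]
  note from_kR = embeds_Cp_k_space_imp_kR_space[OF from_k]
  show ?thesis
    by (intro conjI iffI impI)
      (assumption | erule to_diagonal from_product from_sum from_paracompact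
        from_locally_compact from_k from_kR)+
qed

end
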